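(* If $G$ is a graph on $n$ vertices and $\operatorname{Z}(G) \le \sqrt{n}$, then $\operatorname{Z}(G) \le \alpha(G)$.
   Context: All graphs are simple, finite and undirected. $\alpha(G)$ is the independence number of $G$. Zero forcing: given a set $B\subseteq V(G)$ of initially blue vertices (the rest white), if a blue vertex has exactly one white neighbor $w$, it can force $w$ to become blue; this rule is applied repeatedly. $B$ is a zero forcing set if all vertices can eventually become blue. $\operatorname{Z}(G)$ is the minimum cardinality of a zero forcing set of $G$. *)

theory Defs
  imports Complex_Main "Graph_Theory.Pair_Digraph"
begin

text \<open>
  A finite simple undirected graph is a \<^locale>\<open>pair_graph\<close>: its arcs form a symmetric,
  irreflexive relation on its finite vertex set, and an edge \<open>{u, v}\<close> is represented by the
  two arcs \<open>(u, v)\<close> and \<open>(v, u)\<close>.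
\<close>

definition neighbors :: "'a pair_pre_digraph \<Rightarrow> 'a \<Rightarrow> 'a set" where
  "neighbors G u = {v \<in> pverts G. (u, v) \<in> parcs G}"

definition independent_set :: "'a pair_pre_digraph \<Rightarrow> 'a set \<Rightarrow> bool" where
  "independent_set G S \<longleftrightarrow> S \<subseteq> pverts G \<and> (\<forall>u\<in>S. \<forall>v\<in>S. (u, v) \<notin> parcs G)"

definition independence_number :: "'a pair_pre_digraph \<Rightarrow> nat" where
  "independence_number G = Max (card ` {S. independent_set G S})"

text \<open>
  The second argument is the current set of blue vertices; a step performs one single force.
\<close>

definition force_step :: "'a pair_pre_digraph \<Rightarrow> 'a set \<Rightarrow> 'a set \<Rightarrow> bool" where
  "force_step G B B' \<longleftrightarrow> (\<exists>u\<in>B. \<exists>w. neighbors G u - B = {w} \<and> B' = insert w B)"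

definition zero_forcing_set :: "'a pair_pre_digraph \<Rightarrow> 'a set \<Rightarrow> bool" where
  "zero_forcing_set G B \<longleftrightarrow> B \<subseteq> pverts G \<and> (force_step G)\<^sup>*\<^sup>* B (pverts G)"

definition zero_forcing_number :: "'a pair_pre_digraph \<Rightarrow> nat" where
  "zero_forcing_number G = Min (card ` {B. zero_forcing_set G B})"

text \<open>
  For a finite graph both extrema range over finite nonempty sets.
\<close>

lemma finite_independent_sets:
  "pair_graph G \<Longrightarrow> finite {S. independent_set G S}"
  by (rule finite_subset[of _ "Pow (pverts G)"])
    (auto simp: independent_set_def pair_graph_def pair_digraph_def
      intro: pair_fin_digraph.pair_finite_verts)

lemma independent_set_empty: "independent_set G {}"
  by (simp add: independent_set_def)

lemma finite_zero_forcing_sets: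
  "pair_graph G \<Longrightarrow> finite {B. zero_forcing_set G B}"
  by (rule finite_subset[of _ "Pow (pverts G)"])
    (auto simp: zero_forcing_set_def pair_graph_def pair_digraph_def
      intro: pair_fin_digraph.pair_finite_verts)

lemma zero_forcing_set_verts: "zero_forcing_set G (pverts G)"
  by (simp add: zero_forcing_set_def)

end

theory Submission
  imports Defs
begin

text \<open>
  Let \<open>B\<close> be a zero forcing set with \<open>k\<close> elements, and call a blue vertex active
  as long as it has not forced. A force makes one vertex inactive and adds one new active vertex,
  so there are always exactly \<open>k\<close> active vertices. A blue vertex that is no longer active has only
  blue neighbors, so a vertex that turns blue is adjacent, among the earlier blue vertices, only to
  active ones. Hence the order in which the vertices turn blue lets a greedy coloring
  succeed with \<open>k + 1\<close> colors (lemma \<open>force_step_extends_coloring\<close>), and since color classes are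
  independent, \<open>n \<le> (k + 1) \<alpha>(G)\<close> (lemma \<open>zero_forcing_set_card_verts_le\<close>).

  If \<open>k = Z(G)\<close> satisfies \<open>k\<^sup>2 \<le> n\<close>, then \<open>\<alpha>(G) \<le> k - 1\<close> would give
  \<open>n \<le> (k + 1) (k - 1) < k\<^sup>2\<close>, which is absurd.
\<close>

text \<open>
  The state of the greedy coloring when the blue set is \<open>B\<close>. The set \<open>A\<close> stands for the active
  vertices; instead of the history of forces, only its consequences are recorded, namely how many
  active vertices there are and that the other blue vertices have no white neighbor.
\<close>

definition greedy_state :: "'a pair_pre_digraph \<Rightarrow> nat \<Rightarrow> 'a set \<Rightarrow> 'a set \<Rightarrow> ('a \<Rightarrow> nat) \<Rightarrow> bool"
  where
  "greedy_state G k B A c \<longleftrightarrow>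
     A \<subseteq> B \<and> finite A \<and> card A = k \<and> (\<forall>v\<in>B - A. neighbors G v \<subseteq> B) \<and>
     c ` B \<subseteq> {..k} \<and> (\<forall>u\<in>B. \<forall>v\<in>B. (u, v) \<in> parcs G \<longrightarrow> c u \<noteq> c v)"

lemma greedy_state_initial:
  assumes "pair_graph G" and "finite B"
  shows "\<exists>c. greedy_state G (card B) B B c"
proof -
  interpret pair_graph G by fact
  obtain c where c: "bij_betw c B {0..<card B}"
    using ex_bij_betw_finite_nat[OF \<open>finite B\<close>] by blast
  have "c u \<noteq> c v" if "u \<in> B" "v \<in> B" "(u, v) \<in> parcs G" for u v
    using that c no_loops[of "(u, v)"] by (auto simp: bij_betw_def dest: inj_onD)
  moreover have "c ` B \<subseteq> {..card B}"
    using c by (auto simp: bij_betw_def)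
  ultimately show ?thesis
    using \<open>finite B\<close> by (auto simp: greedy_state_def)
qed

text \<open>
  The forcing vertex passes its place among the active vertices on to the vertex that it forces.
  The latter has at most \<open>k\<close> blue neighbors, all of them active, so one of the \<open>k + 1\<close> colors is
  free for it.
\<close>

lemma force_step_extends_coloring:
  assumes "pair_graph G" and state: "greedy_state G k B A c" and "force_step G B B'"
  shows "\<exists>A' c'. greedy_state G k B' A' c'"
proof -
  interpret pair_graph G by fact
  obtain u w where u: "u \<in> B" and uw: "neighbors G u - B = {w}" and B': "B' = insert w B"
    using \<open>force_step G B B'\<close> by (auto simp: force_step_def)
  have A: "A \<subseteq> B" "finite A" "card A = k"
    and closed: "\<And>v. v \<in> B - A \<Longrightarrow> neighbors G v \<subseteq> B"
    and range: "c ` B \<subseteq> {..k}"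
    and proper: "\<And>x y. x \<in> B \<Longrightarrow> y \<in> B \<Longrightarrow> (x, y) \<in> parcs G \<Longrightarrow> c x \<noteq> c y"
    using state by (auto simp: greedy_state_def)
  have w: "w \<notin> B" "w \<in> neighbors G u"
    using uw by auto
  have "u \<in> A"
    using u w closed[of u] by blast
  have "card (c ` A) < card {..k}"
    using card_image_le[OF A(2), of c] A(3) by simp
  then have "\<not> {..k} \<subseteq> c ` A"
    using card_mono[OF finite_imageI[OF A(2)], of "{..k}" c] by linarith
  then obtain i where i: "i \<le> k" "i \<notin> c ` A"
    by auto
  \<comment> \<open>A blue neighbor of the white vertex \<open>w\<close> has a white neighbor, so it is active.\<close>
  have active: "x \<in> A" if "x \<in> B" "(x, w) \<in> parcs G" for x
    using that closed[of x] w(1) uw by (auto simp: neighbors_def)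
  define A' where "A' = insert w (A - {u})"
  define c' where "c' = c(w := i)"
  have "card A' = k"
    using A w(1) \<open>u \<in> A\<close> card_Suc_Diff1[OF A(2) \<open>u \<in> A\<close>]
    by (auto simp: A'_def card_insert_if)
  moreover have "neighbors G v \<subseteq> B'" if "v \<in> B' - A'" for v
    using that closed[of v] uw by (auto simp: A'_def B')
  moreover have "c' x \<noteq> c' y" if xy: "x \<in> B'" "y \<in> B'" "(x, y) \<in> parcs G" for x y
  proof -
    have "x \<noteq> y"
      using xy(3) no_loops[of "(x, y)"] by auto
    moreover have "(y, x) \<in> parcs G"
      using xy(3) arcs_symmetric by blast
    ultimately show ?thesis
      using xy active[of x] active[of y] i(2) proper[of x y]
      by (auto simp: c'_def B')
  qed
  moreover have "c' ` B' \<subseteq> {..k}"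
    using range i(1) by (auto simp: c'_def B')
  moreover have "A' \<subseteq> B'" "finite A'"
    using A by (auto simp: A'_def B')
  ultimately have "greedy_state G k B' A' c'"
    by (simp add: greedy_state_def)
  then show ?thesis
    by blast
qed

lemma zero_forcing_set_coloring:
  assumes "pair_graph G" and "zero_forcing_set G B"
  shows "\<exists>c. c ` pverts G \<subseteq> {..card B} \<and>
    (\<forall>u\<in>pverts G. \<forall>v\<in>pverts G. (u, v) \<in> parcs G \<longrightarrow> c u \<noteq> c v)"
proof -
  interpret pair_graph G by fact
  have "finite B"
    using assms(2) finite_subset[OF _ pair_finite_verts] by (auto simp: zero_forcing_set_def)
  have "(force_step G)\<^sup>*\<^sup>* B (pverts G)"
    using assms(2) by (simp add: zero_forcing_set_def)
  then have "\<exists>A c. greedy_state G (card B) (pverts G) A c"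
  proof (induction rule: rtranclp_induct)
    case base
    show ?case
      using greedy_state_initial[OF assms(1) \<open>finite B\<close>] by blast
  next
    case step
    then show ?case
      using force_step_extends_coloring[OF assms(1)] by blast
  qed
  then show ?thesis
    unfolding greedy_state_def by blast
qed

lemma card_independent_set_le:
  assumes "pair_graph G" and "independent_set G S"
  shows "card S \<le> independence_number G"
  unfolding independence_number_def
  using assms finite_independent_sets by (intro Max_ge) auto

lemma zero_forcing_set_card_verts_le:
  assumes "pair_graph G" and "zero_forcing_set G B"
  shows "card (pverts G) \<le> (card B + 1) * independence_number G"
proof -
  interpret pair_graph G by fact
  obtain c where range: "c ` pverts G \<subseteq> {..card B}"
    and proper: "\<forall>u\<in>pverts G. \<forall>v\<in>pverts G. (u, v) \<in> parcs G \<longrightarrow> c u \<noteq> c v"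
    using zero_forcing_set_coloring[OF assms] by blast
  define color_class where "color_class i = {v \<in> pverts G. c v = i}" for i
  have "card (color_class i) \<le> independence_number G" for i
  proof (rule card_independent_set_le[OF assms(1)])
    show "independent_set G (color_class i)"
      unfolding independent_set_def color_class_def using proper by blast
  qed
  then have "(\<Sum>i\<le>card B. card (color_class i)) \<le> (card B + 1) * independence_number G"
    using sum_bounded_above[of "{..card B}" "\<lambda>i. card (color_class i)" "independence_number G"]
    by simp
  moreover have "pverts G = (\<Union>i\<le>card B. color_class i)"
    using range by (auto simp: color_class_def)
  then have "card (pverts G) \<le> (\<Sum>i\<le>card B. card (color_class i))"
    using card_UN_le[of "{..card B}" color_class] by simp
  ultimately show ?thesis
    by linarith
qed

lemma zero_forcing_number_attained:
  assumes "pair_graph G"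
  obtains B where "zero_forcing_set G B" and "card B = zero_forcing_number G"
proof -
  have "zero_forcing_number G \<in> card ` {B. zero_forcing_set G B}"
    unfolding zero_forcing_number_def
    using finite_zero_forcing_sets[OF assms] zero_forcing_set_verts[of G]
    by (intro Min_in) auto
  then show ?thesis
    using that by auto
qed

theorem corollary27:
  fixes G :: "'a pair_pre_digraph" and n :: nat
  assumes "pair_graph G"
    and "card (pverts G) = n"
    and "real (zero_forcing_number G) \<le> sqrt (real n)"
  shows "zero_forcing_number G \<le> independence_number G"
proof (rule ccontr)
  let ?k = "zero_forcing_number G" and ?\<alpha> = "independence_number G"
  assume "\<not> ?k \<le> ?\<alpha>"
  then obtain m where m: "?k = Suc m" "?\<alpha> \<le> m"
    by (cases ?k) auto
  have "(real ?k)\<^sup>2 \<le> real n"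
    using assms(3) real_le_rsqrt power_mono[OF assms(3), of 2] by simp
  then have "?k\<^sup>2 \<le> n"
    by (metis of_nat_le_iff of_nat_power)
  also have "n \<le> (?k + 1) * ?\<alpha>"
    using zero_forcing_number_attained[OF assms(1)] zero_forcing_set_card_verts_le[OF assms(1)]
      assms(2) by metis
  also have "\<dots> \<le> (?k + 1) * m"
    using m(2) by (intro mult_left_mono) auto
  finally show False
    by (simp add: m(1) power2_eq_square)
qed

end
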